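(* Let $\alpha$ be an odd prime number and let $\epsilon=(\epsilon_1,\epsilon_2,\dots,\epsilon_{\alpha-1})$ be any symmetric sequence of signs, that is, $\epsilon_i=\epsilon_{\alpha-i}\in\{1,-1\}$ for $i=1,\dots,\alpha-1$. If $2$ is a primitive root modulo $\alpha$, then the Riley polynomial of the kmot group $G(\epsilon)$ is irreducible in $\mathbb Z[\lambda]$.
   Context: Let $\alpha\ge 3$ be odd and $\epsilon=(\epsilon_1,\dots,\epsilon_{\alpha-1})$ a symmetric sequence of signs. The kmot group is $G(\epsilon)=\langle x,y\mid wx=yw\rangle$ with $w=x^{\epsilon_1}y^{\epsilon_2}x^{\epsilon_3}y^{\epsilon_4}\cdots x^{\epsilon_{\alpha-2}}y^{\epsilon_{\alpha-1}}$. Its Riley polynomial $\mathcal R(\lambda)\in\mathbb Z[\lambda]$ is the $(1,1)$-entry of the matrix $$W(\epsilon)=\begin{pmatrix}1&1\\0&1\end{pmatrix}^{\epsilon_1}\begin{pmatrix}1&0\\\lambda&1\end{pmatrix}^{\epsilon_2}\begin{pmatrix}1&1\\0&1\end{pmatrix}^{\epsilon_3}\cdots\begin{pmatrix}1&1\\0&1\end{pmatrix}^{\epsilon_{\alpha-2}}\begin{pmatrix}1&0\\\lambda&1\end{pmatrix}^{\epsilon_{\alpha-1}}.$$ *)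

theory Defs
  imports
    "HOL-Analysis.Analysis"
    "HOL-Computational_Algebra.Computational_Algebra"
    "HOL-Number_Theory.Number_Theory"
begin

text \<open>
  The type \<open>int poly ^ 2 ^ 2\<close> represents the 2 by 2 matrices over \<open>\<int>[\<lambda>]\<close>, with the
  indeterminate \<open>\<lambda>\<close> written \<open>[:0, 1:]\<close>.
\<close>

text \<open>
  The operations \<open>*\<close>, \<open>inverse\<close> and \<open>^\<close> on the type \<open>vec\<close> act componentwise, so integer powers
  with respect to the matrix product need their own definition. Negative powers are meaningful
  only for invertible matrices.
\<close>

definition matrix_powi :: "'a::semiring_1 ^ 'n ^ 'n \<Rightarrow> int \<Rightarrow> 'a ^ 'n ^ 'n" where
  "matrix_powi A k =
     (if k \<ge> 0 then (((**) A) ^^ nat k) (mat 1)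
      else (((**) (matrix_inv A)) ^^ nat (- k)) (mat 1))"

definition riley_X :: "int poly ^ 2 ^ 2" where
  "riley_X = vector [vector [1, 1], vector [0, 1]]"

definition riley_Y :: "int poly ^ 2 ^ 2" where
  "riley_Y = vector [vector [1, 0], vector [[:0, 1:], 1]]"

text \<open>
  The image of the word \<open>w = x^\<epsilon>\<^sub>1 y^\<epsilon>\<^sub>2 \<dots> x^\<epsilon>\<^bsub>\<alpha>-2\<^esub> y^\<epsilon>\<^bsub>\<alpha>-1\<^esub>\<close> of the kmot group
  \<open>G(\<epsilon>) = \<langle>x, y | w x = y w\<rangle>\<close> under \<open>x \<mapsto> riley_X\<close>, \<open>y \<mapsto> riley_Y\<close>. Only the values of \<open>\<epsilon>\<close>
  at \<open>1, \<dots>, \<alpha> - 1\<close> are used.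
\<close>

definition riley_W :: "nat \<Rightarrow> (nat \<Rightarrow> int) \<Rightarrow> int poly ^ 2 ^ 2" where
  "riley_W \<alpha> \<epsilon> =
     foldr (\<lambda>i M. matrix_powi (if odd i then riley_X else riley_Y) (\<epsilon> i) ** M) [1..<\<alpha>] (mat 1)"

definition riley_poly :: "nat \<Rightarrow> (nat \<Rightarrow> int) \<Rightarrow> int poly" where
  "riley_poly \<alpha> \<epsilon> = riley_W \<alpha> \<epsilon> $ 1 $ 1"

definition symmetric_signs :: "nat \<Rightarrow> (nat \<Rightarrow> int) \<Rightarrow> bool" where
  "symmetric_signs \<alpha> \<epsilon> \<longleftrightarrow> (\<forall>i\<in>{1..\<alpha> - 1}. \<epsilon> i \<in> {1, -1} \<and> \<epsilon> i = \<epsilon> (\<alpha> - i))"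

end

theory Submission
  imports Defs "Berlekamp_Zassenhaus.Distinct_Degree_Factorization"
begin

text \<open>
  Modulo 2 the signs disappear, and the Riley polynomial becomes a polynomial \<open>r\<close> of degree
  \<open>n = (\<alpha> - 1) / 2\<close> depending only on \<open>\<alpha>\<close>, with \<open>r(z + 1/z) = z\<^sup>-\<^sup>n (1 + z + \<dots> + z\<^sup>2\<^sup>n)\<close>. Instead of
  working with the cyclotomic polynomial in \<open>z\<close>, we stay in \<open>\<lambda> = z + 1/z\<close> and use the Dickson
  polynomials \<open>D\<^sub>k(z + 1/z) = z\<^sup>k + z\<^sup>-\<^sup>k\<close>, for which \<open>\<lambda> r\<^sup>2 = D\<^sub>\<alpha>\<close> modulo 2. If \<open>f\<close> is an
  irreducible factor of \<open>r\<close> of degree \<open>d\<close> and \<open>q = 2\<^sup>d\<close>, then \<open>f\<close> divides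
  \<open>(\<lambda>\<^sup>q - \<lambda>)\<^sup>2 = D\<^bsub>q+1\<^esub> D\<^bsub>q-1\<^esub>\<close>. Since \<open>f\<close> does not divide two Dickson polynomials of coprime
  index, \<open>\<alpha>\<close> divides \<open>q\<^sup>2 - 1 = 2\<^bsup>2d\<^esup> - 1\<close>, and primitivity of 2 yields \<open>d \<ge> n\<close>. A factorisation
  over the integers thus has a factor that is constant modulo 2, hence constant for degree reasons,
  hence a unit because the constant coefficient of the Riley polynomial is 1.
\<close>

hide_const (open) Matrix.mat
no_notation vec_index (infixl \<open>$\<close> 100)
no_notation fps_nth (infixl \<open>$\<close> 75)

section \<open>Dickson polynomials\<close>

fun dickson :: "'a::comm_ring_1 \<Rightarrow> nat \<Rightarrow> 'a" where
  "dickson x 0 = 2"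
| "dickson x (Suc 0) = x"
| "dickson x (Suc (Suc n)) = x * dickson x (Suc n) - dickson x n"

text \<open>
  In terms of \<open>x = z + 1/z\<close>, this is \<open>z\<^sup>-\<^sup>n (1 + z + \<dots> + z\<^sup>2\<^sup>n)\<close>.
\<close>

fun half_dickson :: "'a::comm_ring_1 \<Rightarrow> nat \<Rightarrow> 'a" where
  "half_dickson x 0 = 1"
| "half_dickson x (Suc 0) = x + 1"
| "half_dickson x (Suc (Suc n)) = x * half_dickson x (Suc n) - half_dickson x n"

text \<open>With \<open>x = z + 1/z\<close> this multiplies out
  \<open>(z^(a+b) + z^-(a+b)) (z^b + z^-b)\<close>. Indexing by \<open>a + b\<close> and
  \<open>b\<close> avoids truncated subtraction.\<close>

lemma dickson_mult:
  "dickson x (a + b) * dickson x b = dickson x (a + 2 * b) + dickson x a"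
proof (induction b arbitrary: a rule: induct_nat_012)
  case (ge2 b)
  have "dickson x (a + b + 2) * dickson x (b + 2)
      = x * (dickson x (a + 1 + Suc b) * dickson x (Suc b)) - dickson x (a + 2 + b) * dickson x b"
    by (simp add: algebra_simps)
  also have "\<dots> = x * (dickson x (a + 1 + 2 * Suc b) + dickson x (a + 1))
      - (dickson x (a + 2 + 2 * b) + dickson x (a + 2))"
    by (simp only: ge2.IH)
  also have "\<dots> = dickson x (a + 2 * (b + 2)) + dickson x a"
    by (simp add: algebra_simps)
  finally show ?case by simp
qed (simp_all add: algebra_simps)

lemma dickson_double: "dickson x (2 * a) = dickson x a ^ 2 - 2"
  using dickson_mult[of x 0 a] by (simp add: power2_eq_square algebra_simps)

lemma dickson_Suc_diff: "dickson x (Suc n) - dickson x n = (x - 2) * half_dickson x n"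
proof (induction n rule: induct_nat_012)
  case (ge2 n)
  have "dickson x (Suc (Suc (Suc n))) - dickson x (Suc (Suc n))
      = x * (dickson x (Suc (Suc n)) - dickson x (Suc n)) - (dickson x (Suc n) - dickson x n)"
    by (simp add: algebra_simps)
  then show ?case
    by (simp only: ge2.IH) (simp add: algebra_simps)
qed (simp_all add: algebra_simps)

text \<open>In terms of \<open>z\<close>, both sides equal
  \<open>((z - 1) (z^(2n+1) - 1) / z^(n+1))^2\<close>.\<close>

lemma dickson_Suc_diff_square:
  "(dickson x (Suc n) - dickson x n) ^ 2 = (x - 2) * (dickson x (Suc (2 * n)) - 2)"
proof -
  have "(dickson x (Suc n) - dickson x n) ^ 2
      = dickson x (2 * Suc n) + 2 + (dickson x (2 * n) + 2) - 2 * (dickson x (1 + n) * dickson x n)"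
    unfolding dickson_double by (simp add: power2_eq_square algebra_simps)
  then show ?thesis
    unfolding dickson_mult by (simp add: algebra_simps)
qed

text \<open>The hypothesis \<open>f dvd 2\<close> covers \<open>k = 0\<close>, where the Dickson
  polynomial is the constant 2.\<close>

lemma dvd_dickson_mult:
  assumes "f dvd 2" and "f dvd dickson x m"
  shows "f dvd dickson x (k * m)"
proof (induction k rule: induct_nat_012)
  case (ge2 k)
  have "dickson x (Suc (Suc k) * m) = dickson x (k * m + m) * dickson x m - dickson x (k * m)"
    unfolding dickson_mult by (simp add: algebra_simps mult_2_right)
  then show ?case
    using ge2 assms by simp
qed (use assms in simp_all)

text \<open>Bezout provides multiples of \<open>n\<close> and \<open>m\<close> that are consecutive,
  \<open>?q\<close> and \<open>Suc ?q\<close>. The product and the squared difference of the two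
  Dickson values then relate \<open>f\<close> to \<open>x\<close>.\<close>

lemma prime_dvd_dickson_coprime:
  fixes f :: "'a::idom"
  assumes "prime_elem f" and "f dvd 2" and "f dvd dickson x m" and "f dvd dickson x n"
    and "gcd m n = 1"
  shows "f dvd x"
\<comment> \<open>Bezout needs \<open>m\<close> nonzero; for \<open>m = 0\<close> the gcd condition
  forces \<open>n = 1\<close>, and \<open>dickson x 1\<close> is \<open>x\<close>.\<close>
proof (cases "m = 0")
  case True
  then show ?thesis using assms by simp
next
  case False
  then obtain u v where uv: "m * u = n * v + 1"
    using bezout_nat[of m n] assms(5) by auto
  let ?q = "v * n"
  have P: "f dvd dickson x (Suc ?q)" and Q: "f dvd dickson x ?q"
    using dvd_dickson_mult[OF assms(2,3), of u] dvd_dickson_mult[OF assms(2,4), of v] uv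
    by (simp_all add: mult.commute)
  have sum: "f dvd dickson x (Suc (2 * ?q)) + x"
    using dickson_mult[of x 1 ?q] P by (metis One_nat_def dickson.simps(2) dvd_mult2 plus_1_eq_Suc)
  have "f dvd (dickson x (Suc ?q) - dickson x ?q) ^ 2"
    using P Q by (simp add: power2_eq_square)
  then have "f dvd x - 2 \<or> f dvd dickson x (Suc (2 * ?q)) - 2"
    unfolding dickson_Suc_diff_square using assms(1) by (simp add: prime_elem_dvd_mult_iff)
  then show ?thesis
  proof
    assume "f dvd x - 2"
    then show ?thesis using assms(2) dvd_add[of f "x - 2" 2] by simp
  next
    assume "f dvd dickson x (Suc (2 * ?q)) - 2"
    then have "f dvd dickson x (Suc (2 * ?q))"
      using assms(2) dvd_add[of f "dickson x (Suc (2 * ?q)) - 2" 2] by simp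
    then show ?thesis using sum by (simp add: dvd_add_right_iff)
  qed
qed

text \<open>In characteristic 2, doubling the index is squaring.\<close>

lemma dickson_two_power:
  assumes "(2::'a::comm_ring_1) = 0"
  shows "dickson (x::'a) (2 ^ k) = x ^ (2 ^ k)"
  by (induction k) (simp_all add: dickson_double assms power_mult[symmetric] mult.commute)

text \<open>The square identity is used with an extra factor \<open>x\<close> on both sides; not
  cancelling it gives the alternative \<open>f dvd x\<close>.\<close>

lemma dvd_dickson_Suc_double:
  fixes f x :: "'a::idom"
  assumes "prime_elem f" and "(2::'a) = 0" and "f dvd half_dickson x n"
  shows "f dvd x \<or> f dvd dickson x (Suc (2 * n))"
proof -
  have "x * dickson x (Suc (2 * n)) = (x * half_dickson x n) ^ 2"
    using dickson_Suc_diff_square[of x n] unfolding dickson_Suc_diff by (simp add: assms(2))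
  then have "f dvd x * dickson x (Suc (2 * n))"
    using assms(3) by (metis dvd_mult power2_eq_square)
  then show ?thesis
    using assms(1) by (simp add: prime_elem_dvd_mult_iff)
qed

lemma degree_half_dickson:
  "degree (half_dickson [:0, 1 :: 'a::idom:] n) = n"
proof (induction n rule: induct_nat_012)
  case (ge2 n)
  let ?r = "half_dickson [:0, 1 :: 'a:]"
  have "?r (Suc n) \<noteq> 0"
    using ge2 by auto
  then have "degree ([:0, 1:] * ?r (Suc n)) = Suc (Suc n)"
    using ge2 by (simp add: degree_mult_eq)
  then have "degree ([:0, 1:] * ?r (Suc n) + - ?r n) = Suc (Suc n)"
    using ge2 by (subst degree_add_eq_left) simp_all
  then show ?case
    by simp
qed (use degree_add_eq_left[of 1 "[:0, 1 :: 'a:]"] in simp_all)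

lemma poly_0_half_dickson:
  assumes "(2::'a::comm_ring_1) = 0"
  shows "poly (half_dickson [:0, 1:] n) 0 = (1::'a)"
proof -
  have "- 1 = (1::'a)"
    using assms by (metis add_eq_0_iff one_add_one)
  then show ?thesis
    by (induction n rule: induct_nat_012) simp_all
qed

section \<open>Irreducibility modulo 2\<close>

text \<open>\<open>bool\<close> has two elements, so \<open>bool mod_ring\<close> is the field with
  two elements.\<close>

lemma two_mod_ring_bool [simp]: "(2 :: bool mod_ring) = 0"
  using of_nat_card_eq_0[where ?'a = bool] by simp

lemma two_mod_ring_bool_poly: "(2 :: bool mod_ring poly) = 0"
  by (simp add: numeral_poly)

lemma primroot_dvd_degree:
  fixes f :: "bool mod_ring poly"
  assumes "prime p" and "residue_primroot p 2" and "irreducible f"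
    and "f dvd dickson [:0, 1:] p" and "\<not> f dvd [:0, 1:]"
  shows "p - 1 dvd 2 * degree f"
proof -
  let ?t = "[:0, 1:] :: bool mod_ring poly"
  let ?d = "degree f"
  let ?q = "2 ^ ?d :: nat"
  have prime_f: "prime_elem f"
    using assms(3) by (rule irreducible_imp_prime_elem)
  \<comment> \<open>Index arithmetic for \<open>dickson_mult\<close> with \<open>a = 2\<close> and
    \<open>b = ?q - 1\<close>.\<close>
  have q: "2 * 1 + (?q - 1) = ?q + 1" "2 * 1 + 2 * (?q - 1) = 2 * ?q"
    using one_le_power[of "2::nat" ?d] by arith+
  have "dickson ?t (?q + 1) * dickson ?t (?q - 1) = dickson ?t (2 * ?q) + dickson ?t (2 * 1)"
    using dickson_mult[of ?t "2 * 1" "?q - 1"] by (simp only: q)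
  also have "\<dots> = (?t ^ ?q) ^ 2 + ?t ^ 2"
    unfolding dickson_double dickson_two_power[OF two_mod_ring_bool_poly]
    by (simp add: two_mod_ring_bool_poly)
  also have "\<dots> = (?t ^ ?q - ?t) ^ 2 + 2 * (?t ^ ?q * ?t)"
    by (simp add: power2_eq_square algebra_simps)
  finally have prod: "dickson ?t (?q + 1) * dickson ?t (?q - 1) = (?t ^ ?q - ?t) ^ 2"
    by (simp add: two_mod_ring_bool_poly)
  \<comment> \<open>An irreducible polynomial of degree \<open>d\<close> over the field with two
    elements divides \<open>t^(2^d) - t\<close>.\<close>
  have "f dvd ?t ^ ?q - ?t"
    using degree_divisor1[OF assms(3) refl] by (simp add: monom_Suc)
  then have "f dvd dickson ?t (?q + 1) \<or> f dvd dickson ?t (?q - 1)"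
    using prod prime_f by (metis power2_eq_square prime_elem_dvd_mult_iff)
  moreover have "p dvd m" if "f dvd dickson ?t m" for m
  proof (rule ccontr)
    assume "\<not> p dvd m"
    then have "gcd p m = 1"
      using assms(1) by (metis prime_imp_coprime_nat coprime_iff_gcd_eq_1)
    then show False
      using prime_dvd_dickson_coprime[OF prime_f _ assms(4) that] assms(5)
      by (simp add: two_mod_ring_bool_poly)
  qed
  ultimately have "p dvd (?q + 1) * (?q - 1)"
    by (metis dvd_mult dvd_mult2)
  also have "(?q + 1) * (?q - 1) = 2 ^ (2 * ?d) - 1"
    by (simp add: algebra_simps power_mult power2_eq_square power_mult_distrib[symmetric] mult_2 power_add)
  finally have "[2 ^ (2 * ?d) = 1] (mod p)"
    by (metis cong_altdef_nat one_le_numeral one_le_power)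
  then have "ord p 2 dvd 2 * ?d"
    by (simp only: ord_divides)
  then show ?thesis
    using assms(1,2) by (simp add: residue_primroot_def totient_prime)
qed

lemma half_dickson_divisor_degree:
  fixes g :: "bool mod_ring poly"
  assumes "prime (2 * n + 1)" and "residue_primroot (2 * n + 1) 2"
    and "g dvd half_dickson [:0, 1:] n" and "degree g \<noteq> 0"
  shows "degree g \<ge> n"
proof -
  let ?t = "[:0, 1:] :: bool mod_ring poly"
  have "g \<noteq> 0" "\<not> is_unit g"
    using assms(4) by (auto simp: is_unit_iff_degree)
  then obtain f where f: "f dvd g" "irreducible f"
    using prime_divisor_exists[of g] by (auto simp: prime_def prime_elem_imp_irreducible)
  have prime_f: "prime_elem f"
    using f(2) by (rule irreducible_imp_prime_elem)
  have f_r: "f dvd half_dickson ?t n"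
    using f(1) assms(3) by (rule dvd_trans)
  \<comment> \<open>The constant coefficient of \<open>?r\<close> is 1, so a common divisor of
    \<open>?t\<close> and \<open>?r\<close> is a unit.\<close>
  have "\<not> f dvd ?t"
  proof
    assume "f dvd ?t"
    moreover have "?t dvd half_dickson ?t n - 1"
      using poly_eq_0_iff_dvd[of "half_dickson ?t n - 1" 0]
        poly_0_half_dickson[OF two_mod_ring_bool, of n]
      by simp
    ultimately have "f dvd half_dickson ?t n - (half_dickson ?t n - 1)"
      using f_r by (blast intro: dvd_diff dvd_trans)
    then have "f dvd 1"
      by simp
    then show False
      using f(2) unfolding irreducible_def by blast
  qed
  then have "2 * n dvd 2 * degree f"
    using primroot_dvd_degree[OF assms(1,2) f(2)]
      dvd_dickson_Suc_double[OF prime_f two_mod_ring_bool_poly f_r] by simp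
  then have "n dvd degree f"
    by simp
  moreover have "degree f \<noteq> 0"
    using f(2) by (metis irreducible_def is_unit_iff_degree)
  ultimately have "n \<le> degree f"
    by (auto intro: dvd_imp_le)
  also have "\<dots> \<le> degree g"
    using f(1) \<open>g \<noteq> 0\<close> by (rule dvd_imp_degree_le)
  finally show ?thesis .
qed

section \<open>The Riley matrices\<close>

lemma matrix_inv_eqI:
  fixes A B :: "'a::semiring_1 ^ 'n ^ 'n"
  assumes "A ** B = mat 1" and "B ** A = mat 1"
  shows "matrix_inv A = B"
proof -
  have "A ** matrix_inv A = mat 1 \<and> matrix_inv A ** A = mat 1"
    unfolding matrix_inv_def by (rule someI[of _ B]) (use assms in simp)
  then show ?thesis
    using assms by (metis matrix_mul_assoc matrix_mul_rid)
qed

lemma matrix_powi_sign: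
  assumes "A ** B = mat 1" and "B ** A = mat 1" and "k \<in> {1, -1}"
  shows "matrix_powi A k = (if k = 1 then A else B)"
  using assms(3) matrix_inv_eqI[OF assms(1,2)] by (auto simp: matrix_powi_def)

lemma riley_X_powi:
  assumes "k \<in> {1, -1}"
  shows "matrix_powi riley_X k = vector [vector [1, of_int k], vector [0, 1]]"
proof -
  have *: "riley_X ** vector [vector [1, -1], vector [0, 1]] = mat 1"
    "vector [vector [1, -1], vector [0, 1]] ** riley_X = mat 1"
    by (simp_all add: riley_X_def matrix_matrix_mult_def Finite_Cartesian_Product.mat_def
        Finite_Cartesian_Product.vec_eq_iff forall_2 sum_2)
  show ?thesis
    using assms unfolding matrix_powi_sign[OF * assms] by (auto simp: riley_X_def)
qed

lemma riley_Y_powi: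
  assumes "k \<in> {1, -1}"
  shows "matrix_powi riley_Y k = vector [vector [1, 0], vector [[:0, of_int k:], 1]]"
proof -
  have neg: "[:-1:] = (-1 :: int poly)"
    by (metis minus_pCons minus_zero one_pCons)
  have *: "riley_Y ** vector [vector [1, 0], vector [[:0, -1:], 1]] = mat 1"
    "vector [vector [1, 0], vector [[:0, -1:], 1]] ** riley_Y = mat 1"
    by (simp_all add: riley_Y_def matrix_matrix_mult_def Finite_Cartesian_Product.mat_def
        Finite_Cartesian_Product.vec_eq_iff forall_2 sum_2 neg)
  show ?thesis
    using assms unfolding matrix_powi_sign[OF * assms] by (auto simp: riley_Y_def)
qed

text \<open>Left multiplication acts on the first column alone, so the induction strips the leading
  pair of letters. Modulo 2 the lower entry is \<open>r n - r (n - 1)\<close> for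
  \<open>n > 0\<close>; the form with \<open>r (Suc n)\<close> also covers
  \<open>n = 0\<close>.\<close>

lemma riley_column:
  fixes \<epsilon> :: "nat \<Rightarrow> int" and j n :: nat
  defines "M \<equiv> foldr (\<lambda>i M. matrix_powi (if odd i then riley_X else riley_Y) (\<epsilon> i) ** M)
    [j..<j + 2 * n] (mat 1)"
  defines "p \<equiv> M $ 1 $ 1" and "q \<equiv> M $ 2 $ 1"
  defines "r \<equiv> half_dickson ([:0, 1:] :: bool mod_ring poly)"
  assumes "odd j" and "\<And>i. i \<in> {j..<j + 2 * n} \<Longrightarrow> \<epsilon> i \<in> {1, -1}"
  shows "degree p \<le> n \<and> degree q \<le> n \<and> poly p 0 = 1 \<and> poly q 0 = 0
    \<and> of_int_poly p = r n \<and> of_int_poly q = r (Suc n) - ([:0, 1:] + 1) * r n"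
  using assms(5,6) unfolding p_def q_def M_def
proof (induction n arbitrary: j)
  case 0
  then show ?case
    by (simp add: r_def Finite_Cartesian_Product.mat_def)
next
  case (Suc n)
  define M where "M = foldr (\<lambda>i M. matrix_powi (if odd i then riley_X else riley_Y) (\<epsilon> i) ** M)
    [j + 2..<j + 2 + 2 * n] (mat 1)"
  define p q where "p = M $ 1 $ 1" and "q = M $ 2 $ 1"
  have IH: "degree p \<le> n" "degree q \<le> n" "poly p 0 = 1" "poly q 0 = 0"
    "of_int_poly p = r n" "of_int_poly q = r (Suc n) - ([:0, 1:] + 1) * r n"
    using Suc.IH[of "j + 2"] Suc.prems unfolding p_def q_def M_def by auto
  define q' where "q' = q + [:0, of_int (\<epsilon> (Suc j)):] * p"
  define p' where "p' = p + of_int (\<epsilon> j) * q'"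
  have signs: "\<epsilon> j \<in> {1, -1}" "\<epsilon> (Suc j) \<in> {1, -1}"
    using Suc.prems(2) by auto
  have "[j..<j + 2 * Suc n] = j # Suc j # [j + 2..<j + 2 + 2 * n]"
    by (simp add: upt_conv_Cons)
  then have fold: "foldr (\<lambda>i M. matrix_powi (if odd i then riley_X else riley_Y) (\<epsilon> i) ** M)
      [j..<j + 2 * Suc n] (mat 1)
      = matrix_powi riley_X (\<epsilon> j) ** (matrix_powi riley_Y (\<epsilon> (Suc j)) ** M)" (is "?F = _")
    using Suc.prems(1) by (simp add: M_def)
  have F: "?F $ 1 $ 1 = p'" "?F $ 2 $ 1 = q'"
    unfolding fold riley_X_powi[OF signs(1)] riley_Y_powi[OF signs(2)] p'_def q'_def p_def q_def
    by (simp_all add: matrix_matrix_mult_def sum_2 algebra_simps)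
  have "degree q' \<le> Suc n"
    unfolding q'_def using IH(1,2) signs(2)
    by (intro degree_add_le) (auto intro: order.trans[OF degree_mult_le] order.trans[OF degree_pCons_le])
  moreover from this have "degree p' \<le> Suc n"
    unfolding p'_def using IH(1) signs(1)
    by (intro degree_add_le) (auto intro: order.trans[OF degree_mult_le])
  moreover have "poly q' 0 = 0" "poly p' 0 = 1"
    unfolding p'_def q'_def using IH(3,4) by (simp_all add: )
  moreover have two: "- u = (u :: bool mod_ring poly)" for u
    using two_mod_ring_bool_poly by (metis add_eq_0_iff mult_2 mult_zero_left)
  have sgn: "of_int_poly [:0, of_int (\<epsilon> (Suc j)):] = ([:0, 1:] :: bool mod_ring poly)"
    "of_int_poly (of_int (\<epsilon> j)) = (1 :: bool mod_ring poly)"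
    using signs two_mod_ring_bool by (auto simp: of_int_poly add_eq_0_iff simp flip: one_add_one)
  have q': "of_int_poly q' = r (Suc n) - r n"
    unfolding q'_def of_int_poly_hom.hom_add of_int_poly_hom.hom_mult sgn IH(5,6)
    by (simp add: algebra_simps)
  moreover have "of_int_poly p' = r (Suc n)"
    unfolding p'_def of_int_poly_hom.hom_add of_int_poly_hom.hom_mult sgn IH(5) q' by simp
  \<comment> \<open>The recurrence turns the right side into \<open>- r n - r (Suc n)\<close>, and
    signs do not matter in characteristic 2.\<close>
  moreover have "r (Suc n) - r n = r (Suc (Suc n)) - ([:0, 1:] + 1) * r (Suc n)"
    unfolding r_def using two[of "half_dickson [:0, 1:] (Suc n)"]
    by (simp add: algebra_simps del: mult_pCons_left)
  ultimately show ?case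
    unfolding F by simp
qed

theorem theorem6p1:
  fixes \<alpha> :: nat and \<epsilon> :: "nat \<Rightarrow> int"
  assumes "prime \<alpha>" and "odd \<alpha>"
    and "symmetric_signs \<alpha> \<epsilon>"
    and "residue_primroot \<alpha> 2"
  shows "irreducible (riley_poly \<alpha> \<epsilon>)"
proof -
  obtain n where n: "\<alpha> = 2 * n + 1"
    using assms(2) by (rule oddE)
  have n0: "n \<noteq> 0"
    using assms(1) n by (metis One_nat_def add_0 mult_0_right not_prime_1)
  define R where "R = riley_poly \<alpha> \<epsilon>"
  let ?m = "of_int_poly :: int poly \<Rightarrow> bool mod_ring poly"
  let ?r = "half_dickson ([:0, 1:] :: bool mod_ring poly) n"
  have "\<epsilon> i \<in> {1, -1}" if "i \<in> {1..<1 + 2 * n}" for i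
  proof -
    have "i \<in> {1..\<alpha> - 1}"
      using that n by simp
    then show ?thesis
      using assms(3) unfolding symmetric_signs_def by blast
  qed
  from riley_column[OF odd_one this] have "degree R \<le> n" and at_0: "poly R 0 = 1"
    and R2: "?m R = ?r"
    unfolding R_def riley_poly_def riley_W_def n by (simp_all add: add.commute)
  have deg_r: "degree ?r = n"
    by (rule degree_half_dickson)
  have deg_m: "degree (?m u) \<le> degree u" for u
    by (rule degree_map_poly_le)
  have R0: "R \<noteq> 0"
    using at_0 by auto
  \<comment> \<open>Reduction modulo 2 cannot raise the degree, so the upper bound \<open>n\<close>
    is attained.\<close>
  have degR: "degree R = n"
    using deg_m[of R] R2 deg_r \<open>degree R \<le> n\<close> by simp
  \<comment> \<open>The reduction of \<open>b\<close> already has degree \<open>n\<close>, leaving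
    degree 0 for \<open>a\<close>; evaluation at 0 then shows that the constant \<open>a\<close>
    divides 1.\<close>
  have unit: "a dvd 1" if ab: "R = a * b" and "degree (?m a) = 0" for a b
  proof -
    have r: "?r = ?m a * ?m b"
      using R2 ab by (simp add: of_int_poly_hom.hom_mult)
    then have "?m a \<noteq> 0" "?m b \<noteq> 0"
      using deg_r n0 by auto
    then have "degree (?m b) = n"
      using r deg_r that(2) by (metis add_0 degree_mult_eq)
    then have "degree b \<ge> n"
      using deg_m[of b] by simp
    moreover have "degree a + degree b = n"
      using ab R0 degR by (simp add: degree_mult_eq)
    ultimately have "degree a = 0"
      by simp
    then obtain c where c: "a = [:c:]"
      by (rule degree_eq_zeroE)
    then have "c * poly b 0 = 1"
      using ab at_0 by simp
    then have "c dvd 1"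
      by (metis dvd_triv_left)
    then show ?thesis
      unfolding c by simp
  qed
  have "irreducible R"
  proof (rule irreducibleI)
    show "R \<noteq> 0" by (rule R0)
    show "\<not> R dvd 1"
    proof
      assume "R dvd 1"
      then have "degree R \<le> degree (1 :: int poly)"
        by (rule dvd_imp_degree_le) simp
      then show False using degR n0 by simp
    qed
    fix a b assume ab: "R = a * b"
    have r: "?r = ?m a * ?m b"
      using R2 ab by (simp add: of_int_poly_hom.hom_mult)
    then have nz: "?m a \<noteq> 0" "?m b \<noteq> 0"
      using deg_r n0 by auto
    \<comment> \<open>Two nonconstant factors would each have degree at least \<open>n\<close>,
      while their degrees add up to \<open>n\<close>.\<close>
    have "degree (?m a) = 0 \<or> degree (?m b) = 0"
    proof (rule ccontr)
      assume "\<not> ?thesis"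
      then have "degree (?m a) \<ge> n" "degree (?m b) \<ge> n"
        using half_dickson_divisor_degree[of n] assms(1,4) n r by (metis dvd_triv_left dvd_triv_right)+
      moreover have "degree (?m a) + degree (?m b) = n"
        using nz r deg_r by (metis degree_mult_eq)
      ultimately show False using n0 by simp
    qed
    then show "a dvd 1 \<or> b dvd 1"
      using unit[of a b] unit[of b a] ab by (auto simp: mult.commute)
  qed
  then show ?thesis unfolding R_def .
qed

end
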